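(* Let $m$ be a positive integer. In each of the following cases the displayed identity holds, and the triple consisting of $n_1=6m+6$ and the denominators $n_2,n_3$ of the second and third unit fractions on the right-hand side is a wild solution of the Erdős–Straus equation for $24m+1$. (1) If $m=23r+18+c(23r+19)$ with $r,c\in\mathbb N$, then $$\frac{4}{24m+1}=\frac{1}{6m+6}+\frac{1}{(6r+5)(c+1)(24m+1)}+\frac{1}{6(6r+5)(c+1)(23r+19)(24m+1)}.$$ (2) If $m=69r+10+c(69r+11)$ with $r\in\mathbb N$, $r>0$, $c\in\mathbb N$, then $$\frac{4}{24m+1}=\frac{1}{6m+6}+\frac{1}{3(6r+1)(c+1)(24m+1)}+\frac{1}{6(6r+1)(c+1)(69r+11)(24m+1)}.$$ (3) If $m=69r+33+c(69r+34)$ with $r\in\mathbb N$, $r>0$, $c\in\mathbb N$, then $$\frac{4}{24m+1}=\frac{1}{6m+6}+\frac{1}{9(2r+1)(c+1)(24m+1)}+\frac{1}{18(2r+1)(c+1)(69r+34)(24m+1)}.$$ (4) If $m=46r+6+c(46r+7)$ with $r\in\mathbb N$, $r>0$, $c\in\mathbb N$, then $$\frac{4}{24m+1}=\frac{1}{6m+6}+\frac{1}{2(6r+1)(c+1)(24m+1)}+\frac{1}{3(6r+1)(c+1)(46r+7)(24m+1)}.$$ (5) If $m=138r+66+c(138r+67)$ with $r,c\in\mathbb N$, then $$\frac{4}{24m+1}=\frac{1}{6m+6}+\frac{1}{18(2r+1)(c+1)(24m+1)}+\frac{1}{9(2r+1)(c+1)(138r+67)(24m+1)}.$$ (6) If $m=73+74t+92s(t+1)$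 with $s,t\in\mathbb N$, then $$\frac{4}{24m+1}=\frac{1}{6m+6}+\frac{1}{4(6s+5)(t+1)(24m+1)}+\frac{1}{3(6s+5)(t+1)(46s+37)(24m+1)}.$$ (7) If $m=37+38t+92\ell(t+1)$ with $t\in\mathbb N$ and $\ell$ a positive integer such that $3\nmid 46\ell+19$, then $$\frac{4}{24m+1}=\frac{1}{6m+6}+\frac{1}{12(2\ell+1)(t+1)(24m+1)}+\frac{1}{3(2\ell+1)(t+1)(46\ell+19)(24m+1)}.$$ (8) If $m=138r+112+c(138r+113)$ with $r,c\in\mathbb N$, then $$\frac{4}{24m+1}=\frac{1}{6m+6}+\frac{1}{6(6r+5)(c+1)(24m+1)}+\frac{1}{3(6r+5)(c+1)(138r+113)(24m+1)}.$$ (9) If $m=69r+9+c(69r+10)$ with $r\in\mathbb N$, $r>0$, $c\in\mathbb N$, then $$\frac{4}{24m+1}=\frac{1}{6m+6}+\frac{1}{3(6r+1)(c+1)(24m+1)}+\frac{1}{2(6r+1)(c+1)(69r+10)(24m+1)}.$$ (10) If $m=69r+55+c(69r+56)$ with $r\in\mathbb N$, $r>0$, $c\in\mathbb N$, then $$\frac{4}{24m+1}=\frac{1}{6m+6}+\frac{1}{3(6r+5)(c+1)(24m+1)}+\frac{1}{2(6r+5)(c+1)(69r+56)(24m+1)}.$$ (11) If $m=138r+16+c(138r+17)$ with $r\in\mathbb N$, $r>0$, $c\in\mathbb N$, then $$\frac{4}{24m+1}=\frac{1}{6m+6}+\frac{1}{6(6r+1)(c+1)(24m+1)}+\frac{1}{(6r+1)(c+1)(138r+17)(24m+1)}.$$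 (12) If $m=138r+108+c(138r+109)$ with $r\in\mathbb N$, $r>0$, $c\in\mathbb N$, then $$\frac{4}{24m+1}=\frac{1}{6m+6}+\frac{1}{6(6r+5)(c+1)(24m+1)}+\frac{1}{(6r+5)(c+1)(138r+109)(24m+1)}.$$
   Context: $\mathbb N$ denotes the set of nonnegative integers. For a positive integer $m$, the Erdős–Straus equation for $n=24m+1$ is $\frac{4}{n}=\frac1{n_1}+\frac1{n_2}+\frac1{n_3}$ in positive integers $n_1,n_2,n_3$. For $n_1=6m+k$ with $1\le k\le 12m$ one has $\frac{4}{24m+1}=\frac{1}{6m+k}+\frac{4k-1}{(6m+k)(24m+1)}$. A solution $(n_1,n_2,n_3)$ is called a wild solution if $n_1=6m+k$ for some integer $1\le k\le 12m$ and there exist an integer $L\ge 2$ (called a multiplier) and positive integers $J_1,J_2$ (called the numerator summands) such that $J_1+J_2=L(4k-1)$, $\gcd(L,J_1,J_2)=1$, $\frac1{n_2}=\frac{J_1}{L(6m+k)(24m+1)}$ and $\frac1{n_3}=\frac{J_2}{L(6m+k)(24m+1)}$. *)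

theory Defs imports Complex_Main begin

definition erdos_straus_solution :: "nat \<Rightarrow> nat \<Rightarrow> nat \<Rightarrow> nat \<Rightarrow> bool" where
  "erdos_straus_solution n n1 n2 n3 \<longleftrightarrow>
     n1 > 0 \<and> n2 > 0 \<and> n3 > 0 \<and>
     4 / real n = 1 / real n1 + 1 / real n2 + 1 / real n3"

(* L is the multiplier and J1, J2 are the numerator summands.
   Since 1 \<le> k, the natural-number subtraction 4 * k - 1 does not truncate. *)
definition wild_solution :: "nat \<Rightarrow> nat \<Rightarrow> nat \<Rightarrow> nat \<Rightarrow> bool" where
  "wild_solution m n1 n2 n3 \<longleftrightarrow>
     erdos_straus_solution (24 * m + 1) n1 n2 n3 \<and>
     (\<exists>k L J1 J2. 1 \<le> k \<and> k \<le> 12 * m \<and> n1 = 6 * m + k \<and>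
        L \<ge> 2 \<and> J1 > 0 \<and> J2 > 0 \<and>
        J1 + J2 = L * (4 * k - 1) \<and>
        gcd L (gcd J1 J2) = 1 \<and>
        1 / real n2 = real J1 / real (L * (6 * m + k) * (24 * m + 1)) \<and>
        1 / real n3 = real J2 / real (L * (6 * m + k) * (24 * m + 1)))"

end

theory Submission imports Defs begin

text \<open>
  With \<open>N = 24 * m + 1\<close>, each pair of denominators has the form \<open>n2 = e * N\<close>, \<open>n3 = f * N\<close>,
  and the ratios \<open>(6 * m + 6) / e\<close> and \<open>(6 * m + 6) / f\<close>, written over a common denominator \<open>L\<close>,
  have numerators \<open>J1\<close>, \<open>J2\<close> with \<open>J1 + J2 = 23 * L\<close>. As \<open>4 / N - 1 / (6 * m + 6) = 23 / ((6 * m + 6) * N)\<close>,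
  this gives the identity. In every case \<open>J2\<close> divides 12 and is coprime to \<open>L\<close>, which is \<open>6 * r + 1\<close>,
  \<open>6 * r + 3\<close>, \<open>6 * r + 5\<close> or \<open>2 * r + 1\<close>.
\<close>

text \<open>Pulling \<open>24 * m + 1\<close> out of both denominators turns the two fraction
  conditions into the product equations \<open>e\<close> and \<open>f\<close> over the naturals,
  which need only ring normalisation in each case. The conclusion is a conjunction so that it
  matches a whole case of the theorem, with \<open>k = 6\<close> and
  \<open>4 * k - 1 = 23\<close>.\<close>

lemma wild_solution_of_multiplier:
  fixes m k e f L J1 J2 :: nat
  assumes k: "1 \<le> k" "k \<le> 12 * m"
    and L: "L \<ge> 2" "coprime L J2"
    and J: "J1 > 0" "J2 > 0" "J1 + J2 = L * (4 * k - 1)"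
    and e: "e * J1 = L * (6 * m + k)"
    and f: "f * J2 = L * (6 * m + k)"
  shows "4 / real (24 * m + 1) = 1 / real (6 * m + k)
           + 1 / real (e * (24 * m + 1)) + 1 / real (f * (24 * m + 1)) \<and>
         wild_solution m (6 * m + k) (e * (24 * m + 1)) (f * (24 * m + 1))"
proof -
  define n where "n = 6 * m + k"
  define N where "N = 24 * m + 1"
  have pos: "n > 0" "N > 0" "L > 0" using k L by (auto simp: n_def N_def)
  \<comment> \<open>If \<open>e\<close> or \<open>f\<close> were 0, then \<open>L * n\<close> would
    be 0.\<close>
  have e0: "e > 0" and f0: "f > 0"
    using e f pos by (auto simp: n_def intro!: Nat.gr0I)
  have "real e * real J1 = real L * real n"
    using e by (simp only: n_def flip: of_nat_mult)
  then have e': "1 / real (e * N) = real J1 / real (L * n * N)"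
    using e0 pos by (simp add: field_simps)
  have "real f * real J2 = real L * real n"
    using f by (simp only: n_def flip: of_nat_mult)
  then have f': "1 / real (f * N) = real J2 / real (L * n * N)"
    using f0 pos by (simp add: field_simps)
  have "real (J1 + J2) = real L * (4 * real k - 1)"
    using J(3) k(1) by (simp add: of_nat_diff)
  then have "1 / real (e * N) + 1 / real (f * N)
      = real L * (4 * real k - 1) / real (L * n * N)"
    unfolding e' f' by (simp flip: add_divide_distrib)
  also have "\<dots> = (4 * real k - 1) / (real n * real N)"
    using pos by simp
  \<comment> \<open>The terms in \<open>m\<close> cancel: \<open>4 * n\<close> is
    \<open>24 * m + 4 * k\<close>.\<close>
  also have "4 * real k - 1 = 4 * real n - real N"
    by (simp add: n_def N_def)
  also have "(4 * real n - real N) / (real n * real N) = 4 / real N - 1 / real n"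
    using pos by (simp add: field_simps)
  finally have eq: "4 / real N = 1 / real n + 1 / real (e * N) + 1 / real (f * N)"
    by simp
  \<comment> \<open>A common divisor of all three numbers already divides both \<open>L\<close> and
    \<open>J2\<close>.\<close>
  have "gcd L (gcd J1 J2) = 1"
    using L(2) by (metis coprime_iff_gcd_eq_1 gcd.left_commute gcd_1_nat gcd.commute)
  with eq e' f' show ?thesis
    using k L J e0 f0 pos
    unfolding wild_solution_def erdos_straus_solution_def n_def N_def
    by (intro conjI exI[of _ k] exI[of _ L] exI[of _ J1] exI[of _ J2]) simp_all
qed

text \<open>Modulo 6 the number is the unit 1 or 5, and coprimality to 6 passes to divisors of 6.
  This serves the cases with \<open>J2 = 3\<close> or \<open>J2 = 6\<close>.\<close>

lemma coprime_six_mult_add: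
  fixes r d :: nat
  assumes "a = 1 \<or> a = 5" "d dvd 6"
  shows "coprime (6 * r + a) d"
proof -
  have "coprime a 6"
    using assms(1) by (auto simp: coprime_iff_gcd_eq_1 gcd_non_0_nat)
  then have "coprime (6 * r + a) 6"
    by (simp add: coprime_iff_gcd_eq_1 gcd.commute[of _ 6] gcd_add_mult mult.commute[of 6])
  then show ?thesis
    using assms(2) coprime_divisors[of "6 * r + a" "6 * r + a" d 6] by simp
qed

lemma coprime_odd_4: "odd a \<Longrightarrow> coprime a (4::nat)"
  using coprime_mult_right_iff[of a 2 2] by simp

theorem theorem4p2:
  fixes m :: nat
  assumes "m > 0"
  shows "(\<forall>r c. m = 23 * r + 18 + c * (23 * r + 19) \<longrightarrow>
       4 / real (24 * m + 1) = 1 / real (6 * m + 6)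
         + 1 / real ((6 * r + 5) * (c + 1) * (24 * m + 1))
         + 1 / real (6 * (6 * r + 5) * (c + 1) * (23 * r + 19) * (24 * m + 1)) \<and>
       wild_solution m (6 * m + 6) ((6 * r + 5) * (c + 1) * (24 * m + 1))
         (6 * (6 * r + 5) * (c + 1) * (23 * r + 19) * (24 * m + 1))) \<and>
    (\<forall>r c. r > 0 \<and> m = 69 * r + 10 + c * (69 * r + 11) \<longrightarrow>
       4 / real (24 * m + 1) = 1 / real (6 * m + 6)
         + 1 / real (3 * (6 * r + 1) * (c + 1) * (24 * m + 1))
         + 1 / real (6 * (6 * r + 1) * (c + 1) * (69 * r + 11) * (24 * m + 1)) \<and>
       wild_solution m (6 * m + 6) (3 * (6 * r + 1) * (c + 1) * (24 * m + 1))
         (6 * (6 * r + 1) * (c + 1) * (69 * r + 11) * (24 * m + 1))) \<and>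
    (\<forall>r c. r > 0 \<and> m = 69 * r + 33 + c * (69 * r + 34) \<longrightarrow>
       4 / real (24 * m + 1) = 1 / real (6 * m + 6)
         + 1 / real (9 * (2 * r + 1) * (c + 1) * (24 * m + 1))
         + 1 / real (18 * (2 * r + 1) * (c + 1) * (69 * r + 34) * (24 * m + 1)) \<and>
       wild_solution m (6 * m + 6) (9 * (2 * r + 1) * (c + 1) * (24 * m + 1))
         (18 * (2 * r + 1) * (c + 1) * (69 * r + 34) * (24 * m + 1))) \<and>
    (\<forall>r c. r > 0 \<and> m = 46 * r + 6 + c * (46 * r + 7) \<longrightarrow>
       4 / real (24 * m + 1) = 1 / real (6 * m + 6)
         + 1 / real (2 * (6 * r + 1) * (c + 1) * (24 * m + 1))
         + 1 / real (3 * (6 * r + 1) * (c + 1) * (46 * r + 7) * (24 * m + 1)) \<and>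
       wild_solution m (6 * m + 6) (2 * (6 * r + 1) * (c + 1) * (24 * m + 1))
         (3 * (6 * r + 1) * (c + 1) * (46 * r + 7) * (24 * m + 1))) \<and>
    (\<forall>r c. m = 138 * r + 66 + c * (138 * r + 67) \<longrightarrow>
       4 / real (24 * m + 1) = 1 / real (6 * m + 6)
         + 1 / real (18 * (2 * r + 1) * (c + 1) * (24 * m + 1))
         + 1 / real (9 * (2 * r + 1) * (c + 1) * (138 * r + 67) * (24 * m + 1)) \<and>
       wild_solution m (6 * m + 6) (18 * (2 * r + 1) * (c + 1) * (24 * m + 1))
         (9 * (2 * r + 1) * (c + 1) * (138 * r + 67) * (24 * m + 1))) \<and>
    (\<forall>s t. m = 73 + 74 * t + 92 * s * (t + 1) \<longrightarrow>
       4 / real (24 * m + 1) = 1 / real (6 * m + 6)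
         + 1 / real (4 * (6 * s + 5) * (t + 1) * (24 * m + 1))
         + 1 / real (3 * (6 * s + 5) * (t + 1) * (46 * s + 37) * (24 * m + 1)) \<and>
       wild_solution m (6 * m + 6) (4 * (6 * s + 5) * (t + 1) * (24 * m + 1))
         (3 * (6 * s + 5) * (t + 1) * (46 * s + 37) * (24 * m + 1))) \<and>
    (\<forall>l t. l > 0 \<and> \<not> 3 dvd 46 * l + 19 \<and> m = 37 + 38 * t + 92 * l * (t + 1) \<longrightarrow>
       4 / real (24 * m + 1) = 1 / real (6 * m + 6)
         + 1 / real (12 * (2 * l + 1) * (t + 1) * (24 * m + 1))
         + 1 / real (3 * (2 * l + 1) * (t + 1) * (46 * l + 19) * (24 * m + 1)) \<and>
       wild_solution m (6 * m + 6) (12 * (2 * l + 1) * (t + 1) * (24 * m + 1))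
         (3 * (2 * l + 1) * (t + 1) * (46 * l + 19) * (24 * m + 1))) \<and>
    (\<forall>r c. m = 138 * r + 112 + c * (138 * r + 113) \<longrightarrow>
       4 / real (24 * m + 1) = 1 / real (6 * m + 6)
         + 1 / real (6 * (6 * r + 5) * (c + 1) * (24 * m + 1))
         + 1 / real (3 * (6 * r + 5) * (c + 1) * (138 * r + 113) * (24 * m + 1)) \<and>
       wild_solution m (6 * m + 6) (6 * (6 * r + 5) * (c + 1) * (24 * m + 1))
         (3 * (6 * r + 5) * (c + 1) * (138 * r + 113) * (24 * m + 1))) \<and>
    (\<forall>r c. r > 0 \<and> m = 69 * r + 9 + c * (69 * r + 10) \<longrightarrow>
       4 / real (24 * m + 1) = 1 / real (6 * m + 6)
         + 1 / real (3 * (6 * r + 1) * (c + 1) * (24 * m + 1))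
         + 1 / real (2 * (6 * r + 1) * (c + 1) * (69 * r + 10) * (24 * m + 1)) \<and>
       wild_solution m (6 * m + 6) (3 * (6 * r + 1) * (c + 1) * (24 * m + 1))
         (2 * (6 * r + 1) * (c + 1) * (69 * r + 10) * (24 * m + 1))) \<and>
    (\<forall>r c. r > 0 \<and> m = 69 * r + 55 + c * (69 * r + 56) \<longrightarrow>
       4 / real (24 * m + 1) = 1 / real (6 * m + 6)
         + 1 / real (3 * (6 * r + 5) * (c + 1) * (24 * m + 1))
         + 1 / real (2 * (6 * r + 5) * (c + 1) * (69 * r + 56) * (24 * m + 1)) \<and>
       wild_solution m (6 * m + 6) (3 * (6 * r + 5) * (c + 1) * (24 * m + 1))
         (2 * (6 * r + 5) * (c + 1) * (69 * r + 56) * (24 * m + 1))) \<and>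
    (\<forall>r c. r > 0 \<and> m = 138 * r + 16 + c * (138 * r + 17) \<longrightarrow>
       4 / real (24 * m + 1) = 1 / real (6 * m + 6)
         + 1 / real (6 * (6 * r + 1) * (c + 1) * (24 * m + 1))
         + 1 / real ((6 * r + 1) * (c + 1) * (138 * r + 17) * (24 * m + 1)) \<and>
       wild_solution m (6 * m + 6) (6 * (6 * r + 1) * (c + 1) * (24 * m + 1))
         ((6 * r + 1) * (c + 1) * (138 * r + 17) * (24 * m + 1))) \<and>
    (\<forall>r c. r > 0 \<and> m = 138 * r + 108 + c * (138 * r + 109) \<longrightarrow>
       4 / real (24 * m + 1) = 1 / real (6 * m + 6)
         + 1 / real (6 * (6 * r + 5) * (c + 1) * (24 * m + 1))
         + 1 / real ((6 * r + 5) * (c + 1) * (138 * r + 109) * (24 * m + 1)) \<and>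
       wild_solution m (6 * m + 6) (6 * (6 * r + 5) * (c + 1) * (24 * m + 1))
         ((6 * r + 5) * (c + 1) * (138 * r + 109) * (24 * m + 1)))"
\<comment> \<open>The instantiation splits only conjunctions whose left side is universally
  quantified, so identity and wildness stay together in one goal per case.\<close>
proof (intro conjI[where P = "All P" for P] allI impI, goal_cases)
  \<comment> \<open>Here \<open>m + 1 = (c + 1) * (23 * r + 19)\<close>. The summands are
    \<open>L * (6 * m + 6)\<close> divided by \<open>e\<close> and by \<open>f\<close>, and they add
    up to \<open>138 * r + 115 = 23 * L\<close>. The other cases follow the same pattern.\<close>
  case (1 r c)
  then show ?case
    by (intro wild_solution_of_multiplier
          [where L = "6 * r + 5" and ?J1.0 = "6 * (23 * r + 19)" and ?J2.0 = 1])
      (simp_all add: algebra_simps)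
next
  case (2 r c)
  \<comment> \<open>The hypothesis \<open>r > 0\<close> gives \<open>L \<ge> 2\<close> for
    \<open>L = 6 * r + 1\<close>.\<close>
  then show ?case
    by (intro wild_solution_of_multiplier
          [where L = "6 * r + 1" and ?J1.0 = "2 * (69 * r + 11)" and ?J2.0 = 1])
      (simp_all add: algebra_simps)
next
  case (3 r c)
  \<comment> \<open>The coefficients 9 and 18 contain the factor 3 of
    \<open>6 * r + 3 = 3 * (2 * r + 1)\<close>.\<close>
  then show ?case
    by (intro wild_solution_of_multiplier
          [where L = "6 * r + 3" and ?J1.0 = "2 * (69 * r + 34)" and ?J2.0 = 1])
      (simp_all add: algebra_simps)
next
  case (4 r c)
  then show ?case
    by (intro wild_solution_of_multiplier
          [where L = "6 * r + 1" and ?J1.0 = "3 * (46 * r + 7)" and ?J2.0 = 2])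
      (auto simp: algebra_simps)
next
  case (5 r c)
  then show ?case
    by (intro wild_solution_of_multiplier
          [where L = "6 * r + 3" and ?J1.0 = "138 * r + 67" and ?J2.0 = 2])
      (auto simp: algebra_simps)
next
  case (6 s t)
  \<comment> \<open>Now \<open>m + 1 = 2 * (t + 1) * (46 * s + 37)\<close>; the extra factor 2 makes
    \<open>J2 = 4\<close> possible.\<close>
  then show ?case
    by (intro wild_solution_of_multiplier
          [where L = "6 * s + 5" and ?J1.0 = "3 * (46 * s + 37)" and ?J2.0 = 4])
      (auto simp: coprime_odd_4 algebra_simps)
next
  case (7 l t)
  \<comment> \<open>The pattern of the previous case with multiplier \<open>6 * l + 3\<close> would
    give summands \<open>3 * (46 * l + 19)\<close> and 12; cancelling the common factor 3 leaves
    these witnesses.\<close>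
  then show ?case
    by (intro wild_solution_of_multiplier
          [where L = "2 * l + 1" and ?J1.0 = "46 * l + 19" and ?J2.0 = 4])
      (auto simp: coprime_odd_4 algebra_simps)
next
  case (8 r c)
  then show ?case
    by (intro wild_solution_of_multiplier
          [where L = "6 * r + 5" and ?J1.0 = "138 * r + 113" and ?J2.0 = 2])
      (auto simp: algebra_simps)
next
  case (9 r c)
  \<comment> \<open>From here on \<open>J2\<close> is divisible by 3, so oddness of \<open>L\<close>
    alone no longer gives coprimality.\<close>
  then show ?case using coprime_six_mult_add[of 1 3 r]
    by (intro wild_solution_of_multiplier
          [where L = "6 * r + 1" and ?J1.0 = "2 * (69 * r + 10)" and ?J2.0 = 3])
      (auto simp: algebra_simps)
next
  case (10 r c)
  then show ?case using coprime_six_mult_add[of 5 3 r]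
    by (intro wild_solution_of_multiplier
          [where L = "6 * r + 5" and ?J1.0 = "2 * (69 * r + 56)" and ?J2.0 = 3])
      (auto simp: algebra_simps)
next
  case (11 r c)
  then show ?case using coprime_six_mult_add[of 1 6 r]
    by (intro wild_solution_of_multiplier
          [where L = "6 * r + 1" and ?J1.0 = "138 * r + 17" and ?J2.0 = 6])
      (auto simp: algebra_simps)
next
  case (12 r c)
  then show ?case using coprime_six_mult_add[of 5 6 r]
    by (intro wild_solution_of_multiplier
          [where L = "6 * r + 5" and ?J1.0 = "138 * r + 109" and ?J2.0 = 6])
      (auto simp: algebra_simps)
qed

end
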